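(* Consider the pricing game PADD described in the context under linear pricing ($\mathcal{P}=\mathcal{P}_L$). When the seller's cost $c$ is concave, the piecewise linear concave value function $$u^*(\mathbf{x})=p^*\cdot\min\Big\{\frac{x_1}{x_1^*},\dots,\frac{x_d}{x_d^*},1\Big\},\quad\text{with } p^*=c(\mathbf{x}^* )\ \text{ and }\ \mathbf{x}^*=\arg\max_{\mathbf{x}\in X}\,[v(\mathbf{x})-c(\mathbf{x})],$$ is an optimal buyer imitative value function. Under $u^*$, the trade happens at bundle $\mathbf{x}^*$ with payment $p^*=c(\mathbf{x}^* )$. The seller revenue will be $0$. The buyer extracts the maximum possible surplus $\max_{\mathbf{x}\in X}[v(\mathbf{x})-c(\mathbf{x})]$.
   Context: Setting. A seller sells $d$ types of divisible goods to a buyer. $X\subset\mathbb{R}_+^d$ is the set of feasible bundles; $X$ is convex, closed, of positive measure, and $\mathbf{0}\in X$. The seller's production cost $c(\mathbf{x})$, $\mathbf{x}\in X$, is monotone non-decreasing with $c(\mathbf{0})=0$. The buyer's true value function $v(\mathbf{x})$, $\mathbf{x}\in X$, is concave and monotone non-decreasing with $v(\mathbf{0})=0$. $\mathcal{C}$ is the set of all concave, monotone non-decreasing functions $u:X\to\mathbb{R}_+$ with $u(\mathbf{0})=0$ (the possible imitative value functions). A pricing function $p$ assigns a price $p(\mathbf{x})$ to each bundle, with $p(\mathbf{0})=0$; $\mathcal{P}$ denotes the class of pricing functions available to the seller. $\mathcal{P}_L=\{p: p(\mathbf{x})=\mathbf{p}\cdot\mathbf{x}\text{ for some }\mathbf{p}\in\mathbb{R}_+^d\}$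 is the class of linear pricing functions. The game PADD. The buyer, whose true value function $v$ is unknown to the seller, commits to react optimally according to an imitative value function $u\in\mathcal{C}$. The seller learns $u$ and chooses a revenue-maximizing $p_u\in\mathcal{P}$ against it, i.e. $p_u=\arg\max_{p\in\mathcal{P}}[p(\mathbf{x}_u(p))-c(\mathbf{x}_u(p))]$, where $\mathbf{x}_u(p)=\arg\max_{\mathbf{x}\in X}[u(\mathbf{x})-p(\mathbf{x})]$ is the bundle the buyer then purchases, with buyer ties broken in favor of the seller. The trade happens at bundle $\mathbf{x}_u(p_u)$ with payment $p_u(\mathbf{x}_u(p_u))$. An optimal imitative value function is a maximizer $u\in\mathcal{C}$ of the true buyer utility $v(\mathbf{x}_u(p_u))-p_u(\mathbf{x}_u(p_u))$. The buyer surplus is this true buyer utility, and the seller revenue is the payment minus the production cost of the purchased bundle.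
   Formalization: Optimality of u* is stated for costs c continuous at 0; with a fixed cost (c=1 for x>0, v=√x on [0,1]) it fails, since u=e√x gives the buyer more. Where no best response x_u(p) exists, no trade occurs; seller ties are broken for the buyer. *)

theory Defs
  imports "HOL-Analysis.Analysis"
begin

text \<open>
  Bundles are vectors in \<open>real ^ 'n\<close>, ordered componentwise. Value, cost and pricing functions are
  total functions of which only the values on the feasible set \<open>X\<close> matter.
\<close>

definition value_functions :: "(real ^ 'n) set \<Rightarrow> (real ^ 'n \<Rightarrow> real) set" where
  "value_functions X = {u. concave_on X u \<and> mono_on X u \<and> (\<forall>x\<in>X. 0 \<le> u x) \<and> u 0 = 0}"

definition linear_pricing :: "(real ^ 'n \<Rightarrow> real) set" where
  "linear_pricing = {\<lambda>x. p \<bullet> x | p. 0 \<le> p}"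

definition demand ::
  "(real ^ 'n) set \<Rightarrow> (real ^ 'n \<Rightarrow> real) \<Rightarrow> (real ^ 'n \<Rightarrow> real) \<Rightarrow> (real ^ 'n) set" where
  "demand X u p = {x. is_arg_max (\<lambda>x. u x - p x) (\<lambda>x. x \<in> X) x}"

definition seller_favored_demand ::
  "(real ^ 'n) set \<Rightarrow> (real ^ 'n \<Rightarrow> real) \<Rightarrow> (real ^ 'n \<Rightarrow> real) \<Rightarrow> (real ^ 'n \<Rightarrow> real)
    \<Rightarrow> (real ^ 'n) set" where
  "seller_favored_demand X c u p =
     {x. is_arg_max (\<lambda>x. p x - c x) (\<lambda>x. x \<in> demand X u p) x}"

text \<open>
  The bundles that may be bought at prices \<open>p\<close>. A maximum need not be attained (\<open>X\<close> may be unbounded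
  and a concave \<open>u\<close> may jump at the boundary of \<open>X\<close>); at such prices nothing is traded.
\<close>

definition purchases ::
  "(real ^ 'n) set \<Rightarrow> (real ^ 'n \<Rightarrow> real) \<Rightarrow> (real ^ 'n \<Rightarrow> real) \<Rightarrow> (real ^ 'n \<Rightarrow> real)
    \<Rightarrow> (real ^ 'n) set" where
  "purchases X c u p =
     (if seller_favored_demand X c u p = {} then {0} else seller_favored_demand X c u p)"

text \<open>
  The pairs of a revenue-maximizing pricing function from \<open>P\<close> and a resulting purchase, against the
  imitative value function \<open>u\<close>. The revenue is the same for all bundles in \<open>purchases X c u p\<close>, so
  maximizing over pairs is maximizing over prices.
\<close>

definition responses ::
  "(real ^ 'n) set \<Rightarrow> (real ^ 'n \<Rightarrow> real) \<Rightarrow> (real ^ 'n \<Rightarrow> real) set \<Rightarrow> (real ^ 'n \<Rightarrow> real)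
    \<Rightarrow> ((real ^ 'n \<Rightarrow> real) \<times> (real ^ 'n)) set" where
  "responses X c P u =
     {r. is_arg_max (\<lambda>(p, x). p x - c x) (\<lambda>(p, x). p \<in> P \<and> x \<in> purchases X c u p) r}"

text \<open>
  The responses remaining when ties between seller-optimal responses are resolved in favor of the
  true value function \<open>v\<close> of the buyer, who moves first.
\<close>

definition outcomes ::
  "(real ^ 'n) set \<Rightarrow> (real ^ 'n \<Rightarrow> real) \<Rightarrow> (real ^ 'n \<Rightarrow> real) \<Rightarrow> (real ^ 'n \<Rightarrow> real) set
    \<Rightarrow> (real ^ 'n \<Rightarrow> real) \<Rightarrow> ((real ^ 'n \<Rightarrow> real) \<times> (real ^ 'n)) set" where
  "outcomes X c v P u =
     {r. is_arg_max (\<lambda>(p, x). v x - p x) (\<lambda>r. r \<in> responses X c P u) r}"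

definition optimal_imitative ::
  "(real ^ 'n) set \<Rightarrow> (real ^ 'n \<Rightarrow> real) \<Rightarrow> (real ^ 'n \<Rightarrow> real) \<Rightarrow> (real ^ 'n \<Rightarrow> real) set
    \<Rightarrow> (real ^ 'n \<Rightarrow> real) \<Rightarrow> bool" where
  "optimal_imitative X c v P u \<longleftrightarrow>
     (\<exists>p x. is_arg_max (\<lambda>(u, p, x). v x - p x)
        (\<lambda>(u, p, x). u \<in> value_functions X \<and> (p, x) \<in> responses X c P u) (u, p, x))"

text \<open>
  Coordinates with \<open>xs $ i = 0\<close> are left out of the minimum, i.e. their quotient counts as infinite;
  the quotient \<open>x $ i / 0 = 0\<close> of HOL would make the function vanish.
\<close>

definition leontief_value :: "real \<Rightarrow> real ^ 'n \<Rightarrow> real ^ 'n \<Rightarrow> real" where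
  "leontief_value ps xs x = ps * Min (insert 1 ((\<lambda>i. x $ i / xs $ i) ` {i. xs $ i \<noteq> 0}))"

end

theory Submission
  imports Defs
begin

text \<open>
  Let \<open>m\<close> be the minimum defining \<open>us\<close>. A bundle \<open>x\<close> bought against \<open>us\<close> dominates \<open>m *\<^sub>R xs\<close>, so it
  is worth \<open>m * c xs \<le> c (m *\<^sub>R xs) \<le> c x\<close> to the imitated buyer, by concavity and monotonicity
  of \<open>c\<close>. The seller therefore earns at most \<open>0\<close>, and earns \<open>0\<close> by charging \<open>c xs / xs $ i\<close> for a
  single good \<open>i\<close> that occurs in \<open>xs\<close>. Conversely, under any imitative value function the
  seller can earn \<open>- e\<close> for every \<open>e > 0\<close>: high uniform prices drive the demand to \<open>0\<close>, where
  \<open>c\<close> is continuous. So the buyer can never pay less than the cost of the purchased bundle.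
\<close>

section \<open>Normalized Leontief functions\<close>

lemma leontief_value_scale: "leontief_value ps xs x = ps * leontief_value 1 xs x"
  by (simp add: leontief_value_def)

lemma leontief_value_le_1: "leontief_value 1 xs x \<le> 1"
  by (simp add: leontief_value_def)

lemma leontief_value_le_ratio:
  assumes "xs $ i \<noteq> 0"
  shows "leontief_value 1 xs x \<le> x $ i / xs $ i"
  using assms by (auto simp: leontief_value_def intro!: Min_le)

lemma leontief_value_greatest:
  assumes "a \<le> 1" and "\<And>i. xs $ i \<noteq> 0 \<Longrightarrow> a \<le> x $ i / xs $ i"
  shows "a \<le> leontief_value 1 xs x"
  using assms by (auto simp: leontief_value_def)

lemma leontief_value_self: "leontief_value ps xs xs = ps"
proof -
  have "1 \<le> leontief_value 1 xs xs"
    by (rule leontief_value_greatest) auto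
  then show ?thesis
    using leontief_value_le_1[of xs xs] leontief_value_scale[of ps xs xs] by simp
qed

lemma leontief_value_nonneg:
  assumes "0 \<le> xs" and "0 \<le> x"
  shows "0 \<le> leontief_value 1 xs x"
  using assms by (intro leontief_value_greatest) (auto simp: less_eq_vec_def)

text \<open>The minimum lies below every ratio \<open>x $ i / xs $ i\<close>, and coordinates with
  \<open>xs $ i = 0\<close> only need \<open>0 \<le> x\<close>. So it measures a fraction of
  \<open>xs\<close> that \<open>x\<close> contains.\<close>

lemma leontief_value_scaleR_le:
  assumes "0 \<le> xs" and "0 \<le> x"
  shows "leontief_value 1 xs x *\<^sub>R xs \<le> x"
  unfolding less_eq_vec_def
proof
  fix i
  show "(leontief_value 1 xs x *\<^sub>R xs) $ i \<le> x $ i"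
  proof (cases "xs $ i = 0")
    case True
    then show ?thesis
      using assms by (simp add: less_eq_vec_def)
  next
    case False
    then have "0 < xs $ i"
      using assms by (metis less_eq_vec_def order_le_less zero_index)
    then show ?thesis
      using leontief_value_le_ratio[OF False, of x] by (simp add: field_simps)
  qed
qed

text \<open>A minimum of affine functions: each ratio at a convex combination is the combination of
  the ratios, so combining the minima gives a lower bound of all of them.\<close>

lemma concave_on_leontief_value:
  fixes X :: "(real ^ 'n) set"
  assumes "convex X" and "0 \<le> ps"
  shows "concave_on X (leontief_value ps xs)"
  unfolding concave_on_iff
proof (intro conjI ballI allI impI)
  fix x y :: "real ^ 'n" and a b :: real
  assume ab: "0 \<le> a" "0 \<le> b" "a + b = 1"
  have "a * leontief_value 1 xs x + b * leontief_value 1 xs y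
      \<le> leontief_value 1 xs (a *\<^sub>R x + b *\<^sub>R y)"
  proof (rule leontief_value_greatest)
    have "a * leontief_value 1 xs x + b * leontief_value 1 xs y \<le> a * 1 + b * 1"
      using ab by (intro add_mono mult_left_mono leontief_value_le_1)
    then show "a * leontief_value 1 xs x + b * leontief_value 1 xs y \<le> 1"
      using ab by simp
  next
    fix i assume i: "xs $ i \<noteq> 0"
    have "a * leontief_value 1 xs x + b * leontief_value 1 xs y
        \<le> a * (x $ i / xs $ i) + b * (y $ i / xs $ i)"
      using ab i by (intro add_mono mult_left_mono leontief_value_le_ratio)
    then show "a * leontief_value 1 xs x + b * leontief_value 1 xs y
        \<le> (a *\<^sub>R x + b *\<^sub>R y) $ i / xs $ i"
      by (simp add: add_divide_distrib)
  qed
  from mult_left_mono[OF this \<open>0 \<le> ps\<close>]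
  show "a * leontief_value ps xs x + b * leontief_value ps xs y
      \<le> leontief_value ps xs (a *\<^sub>R x + b *\<^sub>R y)"
    by (subst (1 2 3) leontief_value_scale) (simp add: algebra_simps)
qed (rule assms)

lemma mono_leontief_value:
  fixes xs :: "real ^ 'n"
  assumes "0 \<le> ps" and "0 \<le> xs"
  shows "mono (leontief_value ps xs)"
proof
  fix x y :: "real ^ 'n"
  assume "x \<le> y"
  have "leontief_value 1 xs x \<le> leontief_value 1 xs y"
  proof (rule leontief_value_greatest[OF leontief_value_le_1])
    fix i assume i: "xs $ i \<noteq> 0"
    have "x $ i / xs $ i \<le> y $ i / xs $ i"
      using \<open>x \<le> y\<close> \<open>0 \<le> xs\<close> by (intro divide_right_mono) (auto simp: less_eq_vec_def)
    with leontief_value_le_ratio[OF i, of x] show "leontief_value 1 xs x \<le> y $ i / xs $ i"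
      by simp
  qed
  then show "leontief_value ps xs x \<le> leontief_value ps xs y"
    using \<open>0 \<le> ps\<close> by (subst (1 2) leontief_value_scale) (rule mult_left_mono)
qed

lemma leontief_value_0:
  assumes "0 \<le> xs" and "xs \<noteq> 0"
  shows "leontief_value ps xs 0 = 0"
proof -
  obtain i where "xs $ i \<noteq> 0"
    using \<open>xs \<noteq> 0\<close> by (auto simp: vec_eq_iff)
  from leontief_value_le_ratio[OF this, of 0] leontief_value_nonneg[OF \<open>0 \<le> xs\<close> order_refl]
  show ?thesis
    by (subst leontief_value_scale) simp
qed

text \<open>With \<open>xs = 0\<close> no ratio is left and the function is the constant
  \<open>ps\<close>; the last assumption makes it vanish at \<open>0\<close> in that case
  too.\<close>

lemma leontief_value_in_value_functions:
  assumes "X \<subseteq> {x. 0 \<le> x}" and "convex X" and "0 \<le> xs" and "0 \<le> ps"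
    and "xs = 0 \<Longrightarrow> ps = 0"
  shows "leontief_value ps xs \<in> value_functions X"
proof -
  have "leontief_value ps xs 0 = 0"
    using assms leontief_value_0 by (cases "xs = 0") (auto simp: leontief_value_def)
  moreover have "0 \<le> leontief_value ps xs x" if "x \<in> X" for x
    using leontief_value_nonneg[of xs x] assms that by (subst leontief_value_scale) auto
  ultimately show ?thesis
    using assms mono_on_subset[OF mono_leontief_value[of ps xs], of X]
    by (simp add: value_functions_def concave_on_leontief_value)
qed

lemma leontief_value_le_cost:
  assumes "X \<subseteq> {x. 0 \<le> x}" and "convex X" and "0 \<in> X" and "xs \<in> X" and "x \<in> X"
    and "mono_on X c" and "c 0 = 0" and "concave_on X c"
  shows "leontief_value (c xs) xs x \<le> c x"
proof -
  define m where "m = leontief_value 1 xs x"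
  have nn: "0 \<le> xs" "0 \<le> x"
    using assms by auto
  have m: "0 \<le> m" "m \<le> 1"
    using leontief_value_nonneg[OF nn] leontief_value_le_1 by (auto simp: m_def)
  have "m *\<^sub>R xs \<in> X"
    using convexD[OF \<open>convex X\<close> \<open>0 \<in> X\<close> \<open>xs \<in> X\<close>, of "1 - m" m] m by simp
  \<comment> \<open>The zero term \<open>(1 - m) * c 0\<close> gives the form to which concavity on
    the segment from \<open>0\<close> to \<open>xs\<close> applies.\<close>
  have "leontief_value (c xs) xs x = (1 - m) * c 0 + m * c xs"
    using leontief_value_scale[of "c xs" xs x] \<open>c 0 = 0\<close> by (simp add: m_def)
  also have "\<dots> \<le> c ((1 - m) *\<^sub>R 0 + m *\<^sub>R xs)"
    using assms m by (intro concave_onD) auto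
  also have "\<dots> = c (m *\<^sub>R xs)"
    by simp
  also have "\<dots> \<le> c x"
    using leontief_value_scaleR_le[OF nn] \<open>m *\<^sub>R xs \<in> X\<close> assms
    by (intro mono_onD[of X c]) (auto simp: m_def)
  finally show ?thesis .
qed

section \<open>Purchases and individual rationality\<close>

lemma purchases_nonempty: "purchases X c u p \<noteq> {}"
  by (simp add: purchases_def)

lemma purchases_subset:
  assumes "0 \<in> X"
  shows "purchases X c u p \<subseteq> X"
  using assms
  by (auto simp: purchases_def seller_favored_demand_def demand_def is_arg_max_def split: if_splits)

lemma purchases_demand:
  assumes "x \<in> purchases X c u p"
  shows "x \<in> demand X u p \<or> x = 0 \<and> seller_favored_demand X c u p = {}"
  using assms
  by (auto simp: purchases_def seller_favored_demand_def is_arg_max_def split: if_splits)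

text \<open>Buying nothing is feasible with surplus 0, so an optimal bundle cannot have negative
  surplus.\<close>

lemma individually_rational_demand:
  assumes "0 \<in> X" and "u 0 = 0" and "p 0 = 0" and "x \<in> demand X u p"
  shows "p x \<le> u x"
  using assms by (force simp: demand_def is_arg_max_def not_less)

text \<open>The fallback purchase \<open>0\<close> meets the bound with equality.\<close>

lemma individually_rational_purchase:
  assumes "0 \<in> X" and "u 0 = 0" and "p 0 = 0" and "x \<in> purchases X c u p"
  shows "p x \<le> u x"
  using purchases_demand[OF assms(4)] individually_rational_demand assms(1-3) by fastforce

lemma purchases_revenue_le_0:
  assumes "0 \<in> X" and "u 0 = 0" and "\<And>x. x \<in> X \<Longrightarrow> u x \<le> c x"
    and "p \<in> linear_pricing" and "x \<in> purchases X c u p"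
  shows "p x \<le> c x"
proof -
  have "p 0 = 0"
    using \<open>p \<in> linear_pricing\<close> by (auto simp: linear_pricing_def)
  then have "p x \<le> u x"
    using assms by (intro individually_rational_purchase) auto
  also have "u x \<le> c x"
    using assms purchases_subset by blast
  finally show ?thesis .
qed

section \<open>Linear prices available to the seller\<close>

text \<open>Such a price leaves the imitated buyer surplus at most 0 on nonnegative bundles and
  exactly 0 at \<open>xs\<close>, which makes \<open>xs\<close> an optimal purchase.\<close>

lemma leontief_supporting_price:
  fixes xs :: "real ^ 'n"
  assumes "0 \<le> xs" and "0 \<le> ps" and "xs = 0 \<Longrightarrow> ps = 0"
  obtains p where "p \<in> linear_pricing" and "p xs = ps"
    and "\<And>x. 0 \<le> x \<Longrightarrow> leontief_value ps xs x \<le> p x"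
proof (cases "xs = 0")
  case True
  have "(\<lambda>x. 0 \<bullet> x) \<in> (linear_pricing :: (real ^ 'n \<Rightarrow> real) set)"
    by (force simp: linear_pricing_def)
  with that[of "\<lambda>x. 0 \<bullet> x"] show ?thesis
    using True assms by (simp add: leontief_value_def)
next
  case False
  then obtain i where i: "xs $ i \<noteq> 0"
    by (auto simp: vec_eq_iff)
  then have "0 \<le> xs $ i"
    using \<open>0 \<le> xs\<close> by (simp add: less_eq_vec_def)
  \<comment> \<open>Charging for good \<open>i\<close> alone makes the price \<open>ps\<close> times
    one of the ratios in the minimum.\<close>
  define q :: "real ^ 'n" where "q = axis i (ps / xs $ i)"
  have q: "q \<bullet> x = ps * (x $ i / xs $ i)" for x
    by (simp add: q_def inner_axis')
  have "0 \<le> q"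
    using \<open>0 \<le> ps\<close> \<open>0 \<le> xs $ i\<close> by (simp add: q_def less_eq_vec_def axis_def)
  then have "(\<lambda>x. q \<bullet> x) \<in> linear_pricing"
    by (auto simp: linear_pricing_def)
  moreover have "q \<bullet> xs = ps"
    using i by (simp add: q)
  moreover have "leontief_value ps xs x \<le> q \<bullet> x" for x
    unfolding q using \<open>0 \<le> ps\<close> leontief_value_le_ratio[OF i]
    by (subst leontief_value_scale) (rule mult_left_mono)
  ultimately show ?thesis
    by (rule that)
qed

text \<open>
  An attained demand at the price vector \<open>1\<close> bounds \<open>u\<close> by an affine function on \<open>X\<close>; this is what
  forces the demand to \<open>0\<close> as the uniform price grows. Prices without a purchase yield revenue \<open>0\<close>.
\<close>
lemma almost_nonnegative_revenue:
  fixes X :: "(real ^ 'n) set"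
  assumes "X \<subseteq> {x. 0 \<le> x}" and "0 \<in> X" and "c 0 = 0" and "u 0 = 0"
    and "continuous (at 0 within X) c" and "0 < e"
  obtains p x where "p \<in> linear_pricing" and "x \<in> purchases X c u p" and "- e < p x - c x"
proof -
  define P where "P t = (\<lambda>x :: real ^ 'n. vec t \<bullet> x)" for t
  have P_eq: "P t x = t * (\<Sum>i\<in>UNIV. x $ i)" for t x
    by (simp add: P_def inner_vec_def sum_distrib_left)
  have P_linear: "P t \<in> linear_pricing" if "0 \<le> t" for t
    using that by (auto simp: P_def linear_pricing_def less_eq_vec_def intro!: exI[of _ "vec t"])
  show ?thesis
  proof (cases "\<exists>t\<ge>0. seller_favored_demand X c u (P t) = {}")
    case True
    then obtain t where t: "0 \<le> t" "seller_favored_demand X c u (P t) = {}"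
      by blast
    then have "0 \<in> purchases X c u (P t)"
      by (simp add: purchases_def)
    with t show ?thesis
      using that[of "P t" 0] P_linear \<open>c 0 = 0\<close> \<open>0 < e\<close> by (simp add: P_eq)
  next
    case False
    have "demand X u (P 1) \<noteq> {}"
      using False[simplified, rule_format, of 1]
      by (auto simp: seller_favored_demand_def is_arg_max_def)
    then obtain x0 where x0: "x0 \<in> X" "\<And>x. x \<in> X \<Longrightarrow> u x - P 1 x \<le> u x0 - P 1 x0"
      by (auto simp: demand_def is_arg_max_def not_less)
    \<comment> \<open>The best imitated surplus at unit prices, so \<open>u x\<close> is at most
      \<open>A\<close> plus the coordinate sum of \<open>x\<close>.\<close>
    define A where "A = u x0 - P 1 x0"
    have "0 \<le> A"
      using x0(2)[OF \<open>0 \<in> X\<close>] \<open>u 0 = 0\<close> by (simp add: A_def P_eq)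
    obtain d where "0 < d" and d: "\<And>x. x \<in> X \<Longrightarrow> norm x < d \<Longrightarrow> \<bar>c x\<bar> < e"
      using \<open>continuous (at 0 within X) c\<close> \<open>0 < e\<close> \<open>c 0 = 0\<close>
      unfolding continuous_within_eps_delta by (auto simp: dist_norm)
    \<comment> \<open>From \<open>t * s \<le> u x \<le> A + s\<close> follows
      \<open>(t - 1) * s \<le> A\<close>. One unit of the 2 offsets the slope 1 of the bound; the
      other makes \<open>s < d\<close> strict and covers \<open>A = 0\<close>.\<close>
    define t where "t = A / d + 2"
    have "0 \<le> t"
      using \<open>0 \<le> A\<close> \<open>0 < d\<close> by (simp add: t_def)
    obtain x where x: "x \<in> purchases X c u (P t)"
      using purchases_nonempty by blast
    then have "x \<in> X"
      using purchases_subset \<open>0 \<in> X\<close> by blast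
    then have "0 \<le> x"
      using assms by auto
    define s where "s = (\<Sum>i\<in>UNIV. x $ i)"
    have "norm x \<le> s"
      using norm_le_l1_cart[of x] \<open>0 \<le> x\<close> by (simp add: s_def less_eq_vec_def)
    then have "0 \<le> s"
      using norm_ge_zero order_trans by blast
    have "t * s \<le> u x"
      using individually_rational_purchase[OF _ _ _ x] assms by (simp add: P_eq s_def)
    also have "u x \<le> A + s"
      using x0(2)[OF \<open>x \<in> X\<close>] by (simp add: A_def P_eq s_def)
    finally have "A * s + d * s \<le> d * A"
      using \<open>0 < d\<close> by (simp add: t_def field_simps)
    have "norm x < d"
    proof (rule ccontr)
      assume "\<not> norm x < d"
      then have "d \<le> s"
        using \<open>norm x \<le> s\<close> by simp
      then have "d * A \<le> A * s" and "0 < d * s"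
        using \<open>0 \<le> A\<close> \<open>0 < d\<close> by (auto simp: mult.commute intro: mult_left_mono)
      with \<open>A * s + d * s \<le> d * A\<close> show False
        by simp
    qed
    then have "c x < e"
      using d[OF \<open>x \<in> X\<close>] by simp
    moreover have "0 \<le> P t x"
      using \<open>0 \<le> t\<close> \<open>0 \<le> s\<close> by (simp add: P_eq s_def)
    ultimately have "- e < P t x - c x"
      by simp
    then show ?thesis
      using that P_linear \<open>0 \<le> t\<close> x by blast
  qed
qed

text \<open>If the seller lost money, taking \<open>e\<close> to be the loss would yield a price and
  purchase with strictly higher revenue.\<close>

lemma responses_revenue_nonneg:
  fixes X :: "(real ^ 'n) set"
  assumes "X \<subseteq> {x. 0 \<le> x}" and "0 \<in> X" and "c 0 = 0" and "u 0 = 0"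
    and "continuous (at 0 within X) c" and "(p, x) \<in> responses X c linear_pricing u"
  shows "c x \<le> p x"
proof (rule ccontr)
  assume "\<not> c x \<le> p x"
  then obtain q y where "q \<in> linear_pricing" "y \<in> purchases X c u q" "- (c x - p x) < q y - c y"
    using almost_nonnegative_revenue[of X c u "c x - p x"] assms by auto
  with \<open>(p, x) \<in> responses X c linear_pricing u\<close> show False
    by (fastforce simp: responses_def is_arg_max_def)
qed

text \<open>Continuity at \<open>0\<close> guards only the optimality claim, which compares
  \<open>us\<close> with all imitative value functions. A concave cost may jump at \<open>0\<close>
  (a fixed cost), and small purchases then need not be cheap to produce.\<close>

theorem theorem3:
  fixes X :: "(real ^ 'n) set"
    and c v :: "real ^ 'n \<Rightarrow> real"
    and xs :: "real ^ 'n"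
  assumes "X \<subseteq> {x. 0 \<le> x}" and "convex X" and "closed X"
    and "0 < emeasure lborel X" and "0 \<in> X"
    and "mono_on X c" and "c 0 = 0" and "concave_on X c"
    and "concave_on X v" and "mono_on X v" and "v 0 = 0"
    and "is_arg_max (\<lambda>x. v x - c x) (\<lambda>x. x \<in> X) xs"
  defines "us \<equiv> leontief_value (c xs) xs"
  shows "us \<in> value_functions X \<and>
    (continuous (at 0 within X) c \<longrightarrow> optimal_imitative X c v linear_pricing us) \<and>
    (\<exists>p. (p, xs) \<in> outcomes X c v linear_pricing us \<and> p xs = c xs) \<and>
    (\<forall>(p, x) \<in> outcomes X c v linear_pricing us.
       is_arg_max (\<lambda>x. v x - c x) (\<lambda>x. x \<in> X) x \<and> p x = c x) \<and>
    (\<forall>(p, x) \<in> responses X c linear_pricing us. p x - c x = 0) \<and>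
    (\<forall>(p, x) \<in> outcomes X c v linear_pricing us. v x - p x = (SUP x\<in>X. v x - c x))"
proof -
  define W where "W = v xs - c xs"
  have "xs \<in> X" and W: "\<And>x. x \<in> X \<Longrightarrow> v x - c x \<le> W"
    using assms(12) by (auto simp: is_arg_max_def W_def not_less)
  have "0 \<le> xs"
    using assms \<open>xs \<in> X\<close> by auto
  have "0 \<le> c xs"
    using mono_onD[OF \<open>mono_on X c\<close> \<open>0 \<in> X\<close> \<open>xs \<in> X\<close> \<open>0 \<le> xs\<close>] \<open>c 0 = 0\<close> by simp
  have cost_0: "c xs = 0" if "xs = 0"
    using that \<open>c 0 = 0\<close> by simp
  have us: "us \<in> value_functions X"
    unfolding us_def using assms \<open>0 \<le> xs\<close> \<open>0 \<le> c xs\<close> cost_0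
    by (intro leontief_value_in_value_functions)
  then have "us 0 = 0"
    by (simp add: value_functions_def)
  have us_le_cost: "us x \<le> c x" if "x \<in> X" for x
    unfolding us_def using assms \<open>xs \<in> X\<close> that by (intro leontief_value_le_cost)
  have revenue_le_0: "q x \<le> c x" if "q \<in> linear_pricing" "x \<in> purchases X c us q" for q x
    using purchases_revenue_le_0[of X us c q x] \<open>0 \<in> X\<close> \<open>us 0 = 0\<close> us_le_cost that by blast
  obtain p where p: "p \<in> linear_pricing" "p xs = c xs" "\<And>x. 0 \<le> x \<Longrightarrow> us x \<le> p x"
    using leontief_supporting_price[OF \<open>0 \<le> xs\<close> \<open>0 \<le> c xs\<close> cost_0] unfolding us_def by blast
  have us_xs: "us xs = c xs"
    by (simp add: us_def leontief_value_self)
  have demand_xs: "xs \<in> demand X us p"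
    using p \<open>xs \<in> X\<close> assms(1) us_xs by (fastforce simp: demand_def is_arg_max_def)
  \<comment> \<open>Revenue is at most 0 on the whole demand set and equals 0 at \<open>xs\<close>,
    so seller-favored tie-breaking admits \<open>xs\<close>.\<close>
  have "p x \<le> c x" if "x \<in> demand X us p" for x
  proof -
    have "x \<in> X" and "p 0 = 0"
      using that p(1) by (auto simp: demand_def is_arg_max_def linear_pricing_def)
    then show ?thesis
      using individually_rational_demand[of X us p x] that us_le_cost[of x] \<open>us 0 = 0\<close> \<open>0 \<in> X\<close>
      by simp
  qed
  then have "xs \<in> seller_favored_demand X c us p"
    using demand_xs p(2) by (auto simp: seller_favored_demand_def is_arg_max_def not_less)
  then have purchase_xs: "xs \<in> purchases X c us p"
    by (auto simp: purchases_def)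
  have response_xs: "(p, xs) \<in> responses X c linear_pricing us"
    using p purchase_xs revenue_le_0 by (auto simp: responses_def is_arg_max_def not_less)
  \<comment> \<open>Comparison with the response \<open>(p, xs)\<close> gives revenue at least 0;
    \<open>revenue_le_0\<close> gives the converse.\<close>
  have response: "p' x = c x \<and> x \<in> X" if "(p', x) \<in> responses X c linear_pricing us" for p' x
  proof -
    have p': "p' \<in> linear_pricing" "x \<in> purchases X c us p'"
      using that by (auto simp: responses_def is_arg_max_def)
    moreover have "c x \<le> p' x"
      using that p(1,2) purchase_xs by (force simp: responses_def is_arg_max_def not_less)
    ultimately show ?thesis
      using revenue_le_0[OF p'] purchases_subset[OF \<open>0 \<in> X\<close>] by fastforce
  qed
  have outcome_xs: "(p, xs) \<in> outcomes X c v linear_pricing us"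
    using response_xs p(2) response W by (fastforce simp: outcomes_def is_arg_max_def not_less W_def)
  \<comment> \<open>The competing response \<open>(p, xs)\<close> already gives the buyer
    \<open>W\<close>; as payment equals cost, \<open>x\<close> must attain the maximal
    surplus.\<close>
  have outcome: "is_arg_max (\<lambda>x. v x - c x) (\<lambda>x. x \<in> X) x \<and> p' x = c x \<and> v x - p' x = W"
    if "(p', x) \<in> outcomes X c v linear_pricing us" for p' x
  proof -
    have "(p', x) \<in> responses X c linear_pricing us" and "W \<le> v x - p' x"
      using that response_xs p(2) by (force simp: outcomes_def is_arg_max_def not_less W_def)+
    then show ?thesis
      using response[of p' x] W by (fastforce simp: is_arg_max_def not_less)
  qed
  have SUP_eq: "(SUP x\<in>X. v x - c x) = W"
    using W \<open>xs \<in> X\<close> by (intro cSup_eq_maximum) (auto simp: W_def)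
  have optimal: "optimal_imitative X c v linear_pricing us"
    if c: "continuous (at 0 within X) c"
  proof -
    \<comment> \<open>Payment covers cost under every imitation, so true utility is at most
      \<open>v x - c x\<close>.\<close>
    have "v x - p' x \<le> W"
      if "u \<in> value_functions X" "(p', x) \<in> responses X c linear_pricing u" for u p' x
    proof -
      have "c x \<le> p' x"
        using that assms c
        by (intro responses_revenue_nonneg[of X c u]) (auto simp: value_functions_def)
      moreover have "x \<in> X"
        using that purchases_subset[OF \<open>0 \<in> X\<close>] by (auto simp: responses_def is_arg_max_def)
      ultimately show ?thesis
        using W[of x] by simp
    qed
    then show ?thesis
      unfolding optimal_imitative_def using us response_xs p(2)
      by (intro exI[of _ p] exI[of _ xs]) (auto simp: is_arg_max_def not_less W_def)
  qed
  show ?thesis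
    unfolding SUP_eq using us optimal outcome_xs p(2) outcome response by auto
qed

end
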